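(* Let $S$ be a $\Gamma$-semigroup. If for some $\gamma_0 \in \Gamma$ the semigroup $S_{\gamma_0}$ is a completely simple semigroup (without zero), then $S_\gamma$ is a completely simple semigroup (without zero) for every $\gamma \in \Gamma$.
   Context: Let $S$ and $\Gamma$ be non-empty sets. A $\Gamma$-semigroup is a set $S$ together with a map $S \times \Gamma \times S \to S$, $(a,\gamma,b) \mapsto a\gamma b$, such that $(a\alpha b)\beta c = a\alpha(b\beta c)$ for all $a,b,c \in S$ and $\alpha,\beta \in \Gamma$. For $\gamma \in \Gamma$, $S_\gamma$ denotes the (ordinary) semigroup with underlying set $S$ and multiplication $a \cdot b = a\gamma b$. A completely simple semigroup (without zero) is a semigroup that has no zero element, has no two-sided ideals other than itself (ideals being non-empty), and contains a primitive idempotent, i.e. an idempotent that is minimal among the idempotents with respect to the natural order $e \le f \iff ef = fe = e$. *)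

theory Defs
  imports Main
begin

text \<open>
  Semigroups and Gamma-semigroups are given by explicit carrier sets; outside the carriers
  the operations are unspecified.
\<close>

locale semigroup_on =
  fixes S :: "'a set" and mult :: "'a \<Rightarrow> 'a \<Rightarrow> 'a"
  assumes nonempty: "S \<noteq> {}"
    and closed: "\<And>a b. a \<in> S \<Longrightarrow> b \<in> S \<Longrightarrow> mult a b \<in> S"
    and assoc: "\<And>a b c. a \<in> S \<Longrightarrow> b \<in> S \<Longrightarrow> c \<in> S \<Longrightarrow>
      mult (mult a b) c = mult a (mult b c)"

definition zero_element_on :: "'a set \<Rightarrow> ('a \<Rightarrow> 'a \<Rightarrow> 'a) \<Rightarrow> 'a \<Rightarrow> bool" where
  "zero_element_on S mult z \<longleftrightarrow> z \<in> S \<and> (\<forall>a\<in>S. mult z a = z \<and> mult a z = z)"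

definition two_sided_ideal_on :: "'a set \<Rightarrow> ('a \<Rightarrow> 'a \<Rightarrow> 'a) \<Rightarrow> 'a set \<Rightarrow> bool" where
  "two_sided_ideal_on S mult I \<longleftrightarrow> I \<noteq> {} \<and> I \<subseteq> S \<and>
     (\<forall>s\<in>S. \<forall>i\<in>I. mult s i \<in> I \<and> mult i s \<in> I)"

definition idempotent_on :: "'a set \<Rightarrow> ('a \<Rightarrow> 'a \<Rightarrow> 'a) \<Rightarrow> 'a \<Rightarrow> bool" where
  "idempotent_on S mult e \<longleftrightarrow> e \<in> S \<and> mult e e = e"

text \<open>The natural order; it is only meant to be applied to idempotents.\<close>

definition natural_le :: "('a \<Rightarrow> 'a \<Rightarrow> 'a) \<Rightarrow> 'a \<Rightarrow> 'a \<Rightarrow> bool" where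
  "natural_le mult e f \<longleftrightarrow> mult e f = e \<and> mult f e = e"

definition primitive_idempotent_on :: "'a set \<Rightarrow> ('a \<Rightarrow> 'a \<Rightarrow> 'a) \<Rightarrow> 'a \<Rightarrow> bool" where
  "primitive_idempotent_on S mult e \<longleftrightarrow> idempotent_on S mult e \<and>
     (\<forall>f. idempotent_on S mult f \<and> natural_le mult f e \<longrightarrow> f = e)"

text \<open>
  Completely simple semigroups without zero. Since the element of a one-element semigroup
  is a zero, one-element semigroups are excluded.
\<close>

definition completely_simple_on :: "'a set \<Rightarrow> ('a \<Rightarrow> 'a \<Rightarrow> 'a) \<Rightarrow> bool" where
  "completely_simple_on S mult \<longleftrightarrow> semigroup_on S mult \<and>
     (\<nexists>z. zero_element_on S mult z) \<and>
     (\<forall>I. two_sided_ideal_on S mult I \<longrightarrow> I = S) \<and>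
     (\<exists>e. primitive_idempotent_on S mult e)"

locale gamma_semigroup =
  fixes S :: "'a set" and \<Gamma> :: "'g set" and gmult :: "'a \<Rightarrow> 'g \<Rightarrow> 'a \<Rightarrow> 'a"
  assumes nonempty: "S \<noteq> {}"
    and index_nonempty: "\<Gamma> \<noteq> {}"
    and closed: "\<And>a \<gamma> b. a \<in> S \<Longrightarrow> \<gamma> \<in> \<Gamma> \<Longrightarrow> b \<in> S \<Longrightarrow> gmult a \<gamma> b \<in> S"
    and assoc: "\<And>a b c \<alpha> \<beta>. a \<in> S \<Longrightarrow> b \<in> S \<Longrightarrow> c \<in> S \<Longrightarrow> \<alpha> \<in> \<Gamma> \<Longrightarrow> \<beta> \<in> \<Gamma> \<Longrightarrow>
      gmult (gmult a \<alpha> b) \<beta> c = gmult a \<alpha> (gmult b \<beta> c)"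

definition mult_at :: "('a \<Rightarrow> 'g \<Rightarrow> 'a \<Rightarrow> 'a) \<Rightarrow> 'g \<Rightarrow> 'a \<Rightarrow> 'a \<Rightarrow> 'a" where
  "mult_at gmult \<gamma> = (\<lambda>a b. gmult a \<gamma> b)"

lemma (in gamma_semigroup) semigroup_on_mult_at:
  "\<gamma> \<in> \<Gamma> \<Longrightarrow> semigroup_on S (mult_at gmult \<gamma>)"
  by unfold_locales (simp_all add: mult_at_def nonempty closed assoc)

end

theory Submission
  imports Defs
begin

text \<open>
  Write \<open>ab\<close> for the product at \<open>\<gamma>\<^sub>0\<close>. Simplicity passes from \<open>\<gamma>\<^sub>0\<close> to \<open>\<gamma>\<close> because
  \<open>S \<gamma> I \<gamma> S\<close> is an ideal at \<open>\<gamma>\<^sub>0\<close> contained in \<open>I\<close>, for each ideal \<open>I\<close> at \<open>\<gamma>\<close>.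
  If \<open>e\<close> is a primitive idempotent at \<open>\<gamma>\<^sub>0\<close>, then \<open>e S e\<close> is a group containing \<open>e \<gamma> e\<close>. For
  \<open>a\<close>, \<open>b\<close> in this group, \<open>a \<gamma> b = a (e \<gamma> e) b\<close>, so the inverse of \<open>e \<gamma> e\<close> is its only
  idempotent at \<open>\<gamma>\<close>; and all idempotents below it at \<open>\<gamma>\<close> lie in \<open>e S e\<close>.
\<close>

text \<open>The products \<open>x a y\<close> form an ideal, which simplicity forces to be all of
  \<open>S\<close>.\<close>

lemma (in semigroup_on) simple_factor:
  assumes simple: "\<And>I. two_sided_ideal_on S mult I \<Longrightarrow> I = S"
    and a: "a \<in> S" and c: "c \<in> S"
  obtains x y where "x \<in> S" "y \<in> S" "c = mult (mult x a) y"
proof -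
  let ?J = "{mult (mult x a) y | x y. x \<in> S \<and> y \<in> S}"
  have "two_sided_ideal_on S mult ?J"
    unfolding two_sided_ideal_on_def
  proof (intro conjI ballI)
    show "?J \<noteq> {}" "?J \<subseteq> S"
      using nonempty a closed by blast+
    fix s i assume s: "s \<in> S" and "i \<in> ?J"
    then obtain x y where xy: "x \<in> S" "y \<in> S" "i = mult (mult x a) y"
      by blast
    have "mult s i = mult (mult (mult s x) a) y" "mult i s = mult (mult x a) (mult y s)"
      using xy s a by (simp_all add: assoc closed)
    then show "mult s i \<in> ?J" "mult i s \<in> ?J"
      using xy s closed by blast+
  qed
  then have "c \<in> ?J"
    using simple c by blast
  then show thesis
    using that by blast
qed

text \<open>This makes \<open>e S e\<close> a group. Once \<open>x a y = e\<close> with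
  \<open>x\<close> and \<open>y\<close> in \<open>e S e\<close>, both \<open>a y x\<close> and
  \<open>y x a\<close> are idempotents below \<open>e\<close>, hence equal to \<open>e\<close> by
  primitivity, so \<open>y x\<close> is the inverse of \<open>a\<close>.\<close>

lemma (in semigroup_on) local_inverse:
  assumes simple: "\<And>I. two_sided_ideal_on S mult I \<Longrightarrow> I = S"
    and prim: "primitive_idempotent_on S mult e"
    and a: "a \<in> S" and ea: "mult e a = a" and ae: "mult a e = a"
  obtains b where "b \<in> S" "mult e b = b" "mult b e = b" "mult a b = e" "mult b a = e"
proof -
  have e: "e \<in> S" and ee: "mult e e = e"
    using prim by (auto simp: primitive_idempotent_on_def idempotent_on_def)
  have min: "f = e" if "f \<in> S" "mult f f = f" "mult f e = f" "mult e f = f" for f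
    using prim that
    by (auto simp: primitive_idempotent_on_def idempotent_on_def natural_le_def)
  obtain x0 y0 where x0: "x0 \<in> S" and y0: "y0 \<in> S" and exy: "e = mult (mult x0 a) y0"
    using simple_factor[OF simple a e] by blast
  \<comment> \<open>Cutting the two factors down to \<open>e S e\<close> keeps the product equal to
    \<open>e\<close>, because \<open>a = e a e\<close>.\<close>
  define x where "x = mult e (mult x0 e)"
  define y where "y = mult e (mult y0 e)"
  have x: "x \<in> S" and y: "y \<in> S"
    unfolding x_def y_def using x0 y0 e closed by auto
  \<comment> \<open>The facts ending in \<open>R\<close> repeat an identity with a trailing factor
    \<open>z\<close>, so that it still rewrites after \<open>assoc\<close> has nested products to
    the right.\<close>
  have eR: "mult e (mult e z) = mult e z" if "z \<in> S" for z
    using assoc[OF e e that] ee by simp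
  have ex: "mult e x = x" and xe: "mult x e = x" and ey: "mult e y = y" and ye: "mult y e = y"
    unfolding x_def y_def using x0 y0 e by (simp_all add: assoc closed ee eR)
  have aeR: "mult a (mult e z) = mult a z" if "z \<in> S" for z
    using assoc[OF a e that] ae by simp
  have eaR: "mult e (mult a z) = mult a z" if "z \<in> S" for z
    using assoc[OF e a that] ea by simp
  have eyR: "mult e (mult y z) = mult y z" if "z \<in> S" for z
    using assoc[OF e y that] ey by simp
  have "mult x (mult a y) = mult e (mult (mult (mult x0 a) y0) e)"
    unfolding x_def y_def using x0 y0 e a by (simp add: assoc closed aeR eaR)
  then have xay: "mult x (mult a y) = e"
    by (simp add: exy[symmetric] ee)
  have xayR: "mult x (mult a (mult y z)) = mult e z" if "z \<in> S" for z
    using assoc[OF x closed[OF a y] that] xay assoc[OF a y that] by simp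
  have exR: "mult e (mult x z) = mult x z" if "z \<in> S" for z
    using assoc[OF e x that] ex by simp
  have "mult a (mult y x) = e"
    by (rule min) (use a x y e in
      \<open>simp_all add: assoc closed xayR eaR ex xe\<close>)
  moreover have "mult (mult y x) a = e"
    by (rule min) (use a x y e in
      \<open>simp_all add: assoc closed xayR exR eyR ae\<close>)
  moreover have "mult e (mult y x) = mult y x" "mult (mult y x) e = mult y x"
    using x y e by (simp_all add: assoc eyR xe)
  ultimately show thesis
    using that x y closed by blast
qed

text \<open>Mixed associativity lets the outer factors \<open>x\<close> and \<open>y\<close> of an
  element of \<open>?J\<close> absorb any multiplication at \<open>\<alpha>\<close>.\<close>

lemma (in gamma_semigroup) simple_mult_at:
  assumes \<alpha>: "\<alpha> \<in> \<Gamma>" and \<beta>: "\<beta> \<in> \<Gamma>"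
    and simple: "\<And>J. two_sided_ideal_on S (mult_at gmult \<alpha>) J \<Longrightarrow> J = S"
    and I: "two_sided_ideal_on S (mult_at gmult \<beta>) I"
  shows "I = S"
proof -
  let ?J = "{gmult (gmult x \<beta> i) \<beta> y | x i y. x \<in> S \<and> i \<in> I \<and> y \<in> S}"
  have IS: "I \<subseteq> S" and ne: "I \<noteq> {}"
    and l: "\<And>s i. s \<in> S \<Longrightarrow> i \<in> I \<Longrightarrow> gmult s \<beta> i \<in> I"
    and r: "\<And>s i. s \<in> S \<Longrightarrow> i \<in> I \<Longrightarrow> gmult i \<beta> s \<in> I"
    using I by (auto simp: two_sided_ideal_on_def mult_at_def)
  have JI: "?J \<subseteq> I"
    using l r by blast
  have "two_sided_ideal_on S (mult_at gmult \<alpha>) ?J"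
    unfolding two_sided_ideal_on_def mult_at_def
  proof (intro conjI ballI)
    show "?J \<noteq> {}" "?J \<subseteq> S"
      using nonempty ne JI IS by blast+
    fix s j assume s: "s \<in> S" and "j \<in> ?J"
    then obtain x i y where xiy: "x \<in> S" "i \<in> I" "y \<in> S" "j = gmult (gmult x \<beta> i) \<beta> y"
      by blast
    have "gmult s \<alpha> j = gmult (gmult (gmult s \<alpha> x) \<beta> i) \<beta> y"
      "gmult j \<alpha> s = gmult (gmult x \<beta> i) \<beta> (gmult y \<alpha> s)"
      using xiy s subsetD[OF IS] \<alpha> \<beta> by (simp_all add: assoc closed)
    then show "gmult s \<alpha> j \<in> ?J" "gmult j \<alpha> s \<in> ?J"
      using xiy s \<alpha> closed by blast+
  qed
  then have "?J = S"
    by (rule simple)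
  then show ?thesis
    using JI IS by blast
qed

lemma (in gamma_semigroup) primitive_idempotent_mult_at:
  assumes \<alpha>: "\<alpha> \<in> \<Gamma>" and \<beta>: "\<beta> \<in> \<Gamma>"
    and simple: "\<And>J. two_sided_ideal_on S (mult_at gmult \<alpha>) J \<Longrightarrow> J = S"
    and prim: "primitive_idempotent_on S (mult_at gmult \<alpha>) e"
  shows "\<exists>g. primitive_idempotent_on S (mult_at gmult \<beta>) g"
proof -
  interpret A: semigroup_on S "mult_at gmult \<alpha>"
    using \<alpha> by (rule semigroup_on_mult_at)
  have e: "e \<in> S" and ee: "gmult e \<alpha> e = e"
    using prim by (auto simp: primitive_idempotent_on_def idempotent_on_def mult_at_def)
  define a where "a = gmult e \<beta> e"
  have a: "a \<in> S"
    unfolding a_def using e \<beta> closed by blast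
  have ea: "gmult e \<alpha> a = a" and ae: "gmult a \<alpha> e = a"
    unfolding a_def using assoc[OF e e e \<alpha> \<beta>] assoc[OF e e e \<beta> \<alpha>] ee by simp_all
  obtain g where g: "g \<in> S" and eg: "gmult e \<alpha> g = g" and ge: "gmult g \<alpha> e = g"
    and ag: "gmult a \<alpha> g = e" and ga: "gmult g \<alpha> a = e"
    using A.local_inverse[OF simple prim a] ea ae unfolding mult_at_def by blast
  \<comment> \<open>Inserting \<open>e\<close> on both sides of \<open>\<beta>\<close> turns
    products at \<open>\<beta>\<close> into products at \<open>\<alpha>\<close> with
    \<open>a\<close> in the middle.\<close>
  have sandwich: "gmult u \<beta> v = gmult u \<alpha> (gmult a \<alpha> v)"
    if u: "u \<in> S" and v: "v \<in> S" and ue: "gmult u \<alpha> e = u" and ev: "gmult e \<alpha> v = v" for u v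
  proof -
    have "gmult u \<beta> v = gmult (gmult u \<alpha> e) \<beta> (gmult e \<alpha> v)"
      by (simp only: ue ev)
    also have "\<dots> = gmult u \<alpha> (gmult a \<alpha> v)"
      unfolding a_def using u v e \<alpha> \<beta> by (simp add: assoc closed)
    finally show ?thesis .
  qed
  have "f = g" if f: "f \<in> S" and ff: "gmult f \<beta> f = f"
    and fg: "gmult f \<beta> g = f" and gf: "gmult g \<beta> f = f" for f
  proof -
    \<comment> \<open>Since \<open>f\<close> begins and ends with \<open>g\<close> at
      \<open>\<beta>\<close>, it inherits from \<open>g\<close> that \<open>e\<close> acts as an
      identity at \<open>\<alpha>\<close>.\<close>
    have ef: "gmult e \<alpha> f = f"
      using assoc[OF e g f \<alpha> \<beta>] eg gf by simp
    have fe: "gmult f \<alpha> e = f"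
      using assoc[OF f g e \<beta> \<alpha>] ge fg by simp
    have faf: "gmult f \<alpha> (gmult a \<alpha> f) = f"
      using sandwich[OF f f fe ef] ff by simp
    have "gmult a \<alpha> f = e"
    proof -
      \<comment> \<open>The inverse \<open>h\<close> of \<open>f\<close> in the group cancels the
        left \<open>f\<close> in \<open>f a f = f\<close>.\<close>
      obtain h where h: "h \<in> S" and hf: "gmult h \<alpha> f = e"
        using A.local_inverse[OF simple prim f] ef fe unfolding mult_at_def by blast
      have "e = gmult h \<alpha> (gmult f \<alpha> (gmult a \<alpha> f))"
        by (simp add: faf hf)
      also have "\<dots> = gmult e \<alpha> (gmult a \<alpha> f)"
        using assoc[OF h f closed[OF a \<alpha> f] \<alpha> \<alpha>] hf by simp
      also have "\<dots> = gmult a \<alpha> f"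
        using assoc[OF e a f \<alpha> \<alpha>] ea by simp
      finally show ?thesis by simp
    qed
    \<comment> \<open>Now \<open>f\<close> is a right inverse of \<open>a\<close>, so it agrees with
      the left inverse \<open>g\<close>.\<close>
    then have "g = gmult g \<alpha> (gmult a \<alpha> f)"
      by (simp add: ge)
    also have "\<dots> = f"
      using assoc[OF g a f \<alpha> \<alpha>] ga ef by simp
    finally show ?thesis by simp
  qed
  moreover have "gmult g \<beta> g = g"
    using sandwich[OF g g ge eg] ag ge by simp
  ultimately have "primitive_idempotent_on S (mult_at gmult \<beta>) g"
    using g by (auto simp: primitive_idempotent_on_def idempotent_on_def natural_le_def mult_at_def)
  then show ?thesis ..
qed

theorem theorem1p3:
  fixes S :: "'a set" and \<Gamma> :: "'g set"
    and gmult :: "'a \<Rightarrow> 'g \<Rightarrow> 'a \<Rightarrow> 'a" and \<gamma>\<^sub>0 :: 'g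
  assumes "gamma_semigroup S \<Gamma> gmult"
    and "\<gamma>\<^sub>0 \<in> \<Gamma>"
    and "completely_simple_on S (mult_at gmult \<gamma>\<^sub>0)"
  shows "\<forall>\<gamma>\<in>\<Gamma>. completely_simple_on S (mult_at gmult \<gamma>)"
proof
  fix \<gamma> assume \<gamma>: "\<gamma> \<in> \<Gamma>"
  interpret gamma_semigroup S \<Gamma> gmult by fact
  have simple0: "\<And>I. two_sided_ideal_on S (mult_at gmult \<gamma>\<^sub>0) I \<Longrightarrow> I = S"
    and nozero0: "\<nexists>z. zero_element_on S (mult_at gmult \<gamma>\<^sub>0) z"
    using assms(3) by (auto simp: completely_simple_on_def)
  obtain e where "primitive_idempotent_on S (mult_at gmult \<gamma>\<^sub>0) e"
    using assms(3) by (auto simp: completely_simple_on_def)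
  then have prim: "\<exists>g. primitive_idempotent_on S (mult_at gmult \<gamma>) g"
    using primitive_idempotent_mult_at[OF assms(2) \<gamma> simple0] by blast
  have simple: "I = S" if "two_sided_ideal_on S (mult_at gmult \<gamma>) I" for I
    using simple_mult_at[OF assms(2) \<gamma> simple0 that] .
  have False if "zero_element_on S (mult_at gmult \<gamma>) z" for z
  proof -
    \<comment> \<open>A zero forms an ideal by itself, so \<open>S\<close> would be a single point,
      which is a zero for every product.\<close>
    have "two_sided_ideal_on S (mult_at gmult \<gamma>) {z}"
      using that by (auto simp: two_sided_ideal_on_def zero_element_on_def)
    then have S: "S = {z}"
      using simple by blast
    then have "zero_element_on S (mult_at gmult \<gamma>\<^sub>0) z"
      using closed[of z \<gamma>\<^sub>0 z] assms(2) by (simp add: zero_element_on_def mult_at_def)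
    then show False
      using nozero0 by blast
  qed
  then show "completely_simple_on S (mult_at gmult \<gamma>)"
    using semigroup_on_mult_at[OF \<gamma>] simple prim by (auto simp: completely_simple_on_def)
qed

end
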